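(* Let $x_0\in\mathbb{R}^n$, $x_0\neq 0$, let $\|\cdot\|_{(1)},\dots,\|\cdot\|_{(\tau)}$ be norms on $\mathbb{R}^n$, and let $f(x)=h(\|x\|_{(1)},\dots,\|x\|_{(\tau)})$, where $h:\mathbb{R}_+^\tau\to\mathbb{R}_+$ is convex, non-decreasing in each argument, and strictly increasing in at least one coordinate. Let $A\in\mathbb{R}^{m\times n}$ and $\bar x_0=x_0/\|x_0\|_2$. Suppose $$\rho(x_0,\partial f(x_0)):=\inf_{g\in\partial f(x_0)}\frac{|g^T\bar x_0|}{\|g\|_2}>\frac{\|A\bar x_0\|_2}{\sigma_{\min}(A^T)}.$$ Then $x_0$ is not a minimizer of the program $$\text{minimize}_{x\in\mathbb{R}^n}\ f(x)\quad\text{subject to}\quad Ax=Ax_0 .$$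
   Context: $\partial f(x_0)$ is the convex subdifferential of $f$ at $x_0$ (under these assumptions $0\notin\partial f(x_0)$). $\sigma_{\min}(A^T)=\inf_{\|z\|_2=1}\|A^Tz\|_2$ over $z\in\mathbb{R}^m$; if $\sigma_{\min}(A^T)=0$, the right-hand side of the hypothesis is regarded as $+\infty$, so the hypothesis does not hold. *)

theory Defs
  imports "HOL-Analysis.Analysis"
begin

(* The class constant norm on real^'n is the Euclidean norm; arbitrary norms are functions. *)
definition is_norm :: "('a::real_vector \<Rightarrow> real) \<Rightarrow> bool" where
  "is_norm N \<longleftrightarrow>
     (\<forall>x. 0 \<le> N x) \<and>
     (\<forall>x. N x = 0 \<longleftrightarrow> x = 0) \<and>
     (\<forall>c x. N (c *\<^sub>R x) = \<bar>c\<bar> * N x) \<and>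
     (\<forall>x y. N (x + y) \<le> N x + N y)"

definition nonneg_orthant :: "(real^'t) set" where
  "nonneg_orthant = {v. \<forall>i. 0 \<le> v $ i}"

definition upd_coord :: "real^'t \<Rightarrow> 't \<Rightarrow> real \<Rightarrow> real^'t" where
  "upd_coord v i s = (\<chi> j. if j = i then s else v $ j)"

definition nondecreasing_in_coord :: "(real^'t \<Rightarrow> real) \<Rightarrow> 't \<Rightarrow> bool" where
  "nondecreasing_in_coord h i \<longleftrightarrow>
     (\<forall>v\<in>nonneg_orthant. mono_on {0..} (\<lambda>s. h (upd_coord v i s)))"

definition strictly_increasing_in_coord :: "(real^'t \<Rightarrow> real) \<Rightarrow> 't \<Rightarrow> bool" where
  "strictly_increasing_in_coord h i \<longleftrightarrow>
     (\<forall>v\<in>nonneg_orthant. strict_mono_on {0..} (\<lambda>s. h (upd_coord v i s)))"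

definition subdifferential :: "('a::real_inner \<Rightarrow> real) \<Rightarrow> 'a \<Rightarrow> 'a set" where
  "subdifferential f x = {g. \<forall>y. f x + g \<bullet> (y - x) \<le> f y}"

(* The infimum is taken in the extended reals, so it is infinite for an empty G. *)
definition correlation :: "'a::real_inner \<Rightarrow> 'a set \<Rightarrow> ereal" where
  "correlation x G = (INF g\<in>G. ereal (\<bar>g \<bullet> (x /\<^sub>R norm x)\<bar> / norm g))"

definition sigma_min :: "real^'m^'n \<Rightarrow> real" where
  "sigma_min M = (INF z\<in>{z. norm z = 1}. norm (M *v z))"

(* Division by zero must give infinity, also for a zero numerator;
   neither real nor ereal division has this property. *)
definition ratio_or_infinity :: "real \<Rightarrow> real \<Rightarrow> ereal" where
  "ratio_or_infinity a b = (if b = 0 then \<infinity> else ereal (a / b))"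

end

theory Submission
  imports Defs
begin

text \<open>
  If \<open>x\<^sub>0\<close> were a minimizer, separating the strict epigraph of the convex function \<open>f\<close> from the
  feasible affine subspace at height \<open>f x\<^sub>0\<close> would give a Lagrange multiplier: a subgradient of the
  form \<open>g = A\<^sup>T z\<close>. Since \<open>f 0 < f x\<^sub>0\<close>, \<open>g \<noteq> 0\<close>, and Cauchy--Schwarz bounds
  \<open>\<bar>g \<bullet> x\<^sub>0\<bar> = \<bar>z \<bullet> A x\<^sub>0\<bar>\<close> by \<open>norm g * norm (A x\<^sub>0) / \<sigma>\<close>, where \<open>\<sigma>\<close> is the smallest singular
  value of \<open>A\<^sup>T\<close>.
\<close>

text \<open>Coordinates are raised from \<open>v\<close> to \<open>w\<close> one at a time. The
  hybrid point \<open>p S\<close> has already switched to \<open>w\<close> on \<open>S\<close> and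
  stays in the orthant, so each switch is a single use of one-coordinate monotonicity.\<close>

lemma mono_nonneg_orthant:
  fixes h :: "real^'t::finite \<Rightarrow> real"
  assumes mono: "\<And>i. nondecreasing_in_coord h i"
    and v: "\<And>i. 0 \<le> v $ i" and vw: "\<And>i. v $ i \<le> w $ i"
  shows "h v \<le> h w"
proof -
  define p where "p S = (\<chi> j. if j \<in> S then w $ j else v $ j)" for S
  have w: "0 \<le> w $ i" for i
    using v[of i] vw[of i] by simp
  have "h v \<le> h (p S)" if "finite S" for S
    using that
  proof induction
    case empty
    then show ?case by (simp add: p_def)
  next
    case (insert i S)
    have "p S \<in> nonneg_orthant"
      by (simp add: p_def nonneg_orthant_def v w)
    then have "mono_on {0..} (\<lambda>s. h (upd_coord (p S) i s))"
      using mono[of i] by (auto simp: nondecreasing_in_coord_def)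
    then have "h (upd_coord (p S) i (v $ i)) \<le> h (upd_coord (p S) i (w $ i))"
      using v[of i] w[of i] vw[of i] by (auto simp: mono_on_def)
    moreover have "upd_coord (p S) i (v $ i) = p S"
      using insert.hyps by (auto simp: upd_coord_def p_def vec_eq_iff)
    moreover have "upd_coord (p S) i (w $ i) = p (insert i S)"
      by (auto simp: upd_coord_def p_def vec_eq_iff)
    ultimately show ?case
      using insert.IH by simp
  qed
  from this[of UNIV] show ?thesis
    by (simp add: p_def)
qed

text \<open>By the triangle inequality, the norm vector of a convex combination is dominated by the
  combination of the norm vectors. Monotonicity of \<open>h\<close> passes this on to the values,
  and then convexity of \<open>h\<close> applies.\<close>

lemma convex_on_compose_norms:
  fixes h :: "real^'t::finite \<Rightarrow> real" and N :: "'t \<Rightarrow> 'a::real_vector \<Rightarrow> real"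
  assumes N: "\<And>i. is_norm (N i)"
    and convex: "convex_on nonneg_orthant h"
    and mono: "\<And>i. nondecreasing_in_coord h i"
  shows "convex_on UNIV (\<lambda>x. h (\<chi> i. N i x))"
proof (rule convex_onI)
  fix t :: real and x y :: 'a
  assume t: "0 < t" "t < 1"
  let ?v = "\<lambda>x. \<chi> i. N i x"
  have "h (?v ((1 - t) *\<^sub>R x + t *\<^sub>R y)) \<le> h ((1 - t) *\<^sub>R ?v x + t *\<^sub>R ?v y)"
  proof (rule mono_nonneg_orthant[OF mono])
    fix i
    show "0 \<le> ?v ((1 - t) *\<^sub>R x + t *\<^sub>R y) $ i"
      using N[of i] by (simp add: is_norm_def)
    have "N i ((1 - t) *\<^sub>R x + t *\<^sub>R y) \<le> N i ((1 - t) *\<^sub>R x) + N i (t *\<^sub>R y)"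
      using N[of i] unfolding is_norm_def by blast
    also have "\<dots> = (1 - t) * N i x + t * N i y"
      using N[of i] t by (simp add: is_norm_def)
    finally show "?v ((1 - t) *\<^sub>R x + t *\<^sub>R y) $ i \<le> ((1 - t) *\<^sub>R ?v x + t *\<^sub>R ?v y) $ i"
      by simp
  qed
  also have "\<dots> \<le> (1 - t) * h (?v x) + t * h (?v y)"
    using t N by (intro convex_onD[OF convex]) (auto simp: nonneg_orthant_def is_norm_def)
  finally show "h (?v ((1 - t) *\<^sub>R x + t *\<^sub>R y)) \<le> (1 - t) * h (?v x) + t * h (?v y)" .
qed simp

text \<open>The norm vector of \<open>x\<close> descends to zero in two moves: dropping coordinate
  \<open>i\<close> from \<open>N i x > 0\<close> to 0 loses strictly, and dropping the remaining
  coordinates gains nothing.\<close>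

lemma compose_norms_zero_less:
  fixes h :: "real^'t::finite \<Rightarrow> real" and N :: "'t \<Rightarrow> 'a::real_vector \<Rightarrow> real"
  assumes N: "\<And>i. is_norm (N i)"
    and mono: "\<And>i. nondecreasing_in_coord h i"
    and strict: "strictly_increasing_in_coord h i"
    and "x \<noteq> 0"
  shows "h (\<chi> i. N i 0) < h (\<chi> i. N i x)"
proof -
  let ?v = "\<chi> i. N i x"
  have nonneg: "0 \<le> N j x" and zero: "N j 0 = 0" for j
    using N[of j] by (auto simp: is_norm_def)
  have pos: "0 < N i x"
    using N[of i] \<open>x \<noteq> 0\<close> by (auto simp: is_norm_def order_less_le)
  have "h (\<chi> i. N i 0) \<le> h (upd_coord ?v i 0)"
    by (rule mono_nonneg_orthant[OF mono]) (auto simp: upd_coord_def nonneg zero)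
  also have "?v \<in> nonneg_orthant"
    by (simp add: nonneg_orthant_def nonneg)
  then have "strict_mono_on {0..} (\<lambda>s. h (upd_coord ?v i s))"
    using strict by (auto simp: strictly_increasing_in_coord_def)
  then have "h (upd_coord ?v i 0) < h (upd_coord ?v i (N i x))"
    using pos by (auto simp: strict_mono_on_def)
  also have "upd_coord ?v i (N i x) = ?v"
    by (auto simp: upd_coord_def vec_eq_iff)
  finally show ?thesis .
qed

lemma subgradient_orthogonal_to_subspace:
  fixes f :: "'a::euclidean_space \<Rightarrow> real"
  assumes convex: "convex_on UNIV f" and K: "subspace K"
    and min: "\<And>k. k \<in> K \<Longrightarrow> f x \<le> f (x + k)"
  obtains g where "g \<in> subdifferential f x" "\<And>k. k \<in> K \<Longrightarrow> g \<bullet> k = 0"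
proof -
  let ?C = "{p. f (fst p) < snd p}" and ?D = "(\<lambda>k. (x + k, f x)) ` K"
  have "convex ?C"
  proof (rule convexI)
    fix p q :: "'a \<times> real" and u v :: real
    assume pq: "p \<in> ?C" "q \<in> ?C" and uv: "0 \<le> u" "0 \<le> v" "u + v = 1"
    have "f (u *\<^sub>R fst p + v *\<^sub>R fst q) \<le> u * f (fst p) + v * f (fst q)"
      using convex uv by (auto simp: convex_on_def)
    also have "\<dots> < u * snd p + v * snd q"
    proof (cases "u = 0")
      case False
      then show ?thesis
        using pq uv by (intro add_less_le_mono mult_strict_left_mono mult_left_mono) auto
    qed (use pq uv in auto)
    finally show "u *\<^sub>R p + v *\<^sub>R q \<in> ?C"
      by simp
  qed
  moreover have "convex ?D"
  proof -
    have "?D = (+) (x, f x) ` (\<lambda>k. (k, 0)) ` K"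
      by (auto simp: image_image)
    moreover have "linear (\<lambda>k::'a. (k, 0::real))"
      by (auto intro: linearI)
    ultimately show ?thesis
      by (metis K convex_linear_image convex_translation subspace_imp_convex)
  qed
  moreover have "(x, f x + 1) \<in> ?C"
    by simp
  then have "?C \<noteq> {}"
    by blast
  moreover have "0 \<in> K"
    using K by (rule subspace_0)
  then have "?D \<noteq> {}"
    by blast
  moreover have "?C \<inter> ?D = {}"
    using min by force
  ultimately obtain a b where "a \<noteq> 0" and aC: "\<forall>p\<in>?C. a \<bullet> p \<le> b" and aD: "\<forall>p\<in>?D. a \<bullet> p \<ge> b"
    using separating_hyperplane_sets[of ?C ?D] by blast
  obtain u s where a: "a = (u, s)"
    by (cases a)
  have C: "u \<bullet> y + s * t \<le> b" if "f y < t" for y t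
    using aC that by (auto simp: a)
  have D: "b \<le> u \<bullet> x + u \<bullet> k + s * f x" if "k \<in> K" for k
    using aD that by (auto simp: a inner_add_right)
  \<comment> \<open>Points on the graph are limits of points of the strict epigraph from above, so
    the bound extends to them.\<close>
  have le: "u \<bullet> y + s * f y \<le> b" for y
  proof -
    have "((\<lambda>t. u \<bullet> y + s * t) \<longlongrightarrow> u \<bullet> y + s * f y) (at_right (f y))"
      by (intro tendsto_intros)
    moreover have "\<forall>\<^sub>F t in at_right (f y). u \<bullet> y + s * t \<le> b"
      using C by (auto simp: eventually_at_filter)
    ultimately show ?thesis
      by (rule tendsto_upperbound) simp
  qed
  \<comment> \<open>The point \<open>(x, f x)\<close> lies in \<open>?D\<close> and on the graph, so
    the hyperplane passes through it.\<close>
  have b: "u \<bullet> x + s * f x = b"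
    using le[of x] D[OF \<open>0 \<in> K\<close>] by simp
  have "s \<le> 0"
    using C[of x "f x + 1"] b by (simp add: algebra_simps)
  \<comment> \<open>The hyperplane is not vertical: \<open>f\<close> is finite everywhere, so
    \<open>x + u\<close> is an admissible test point, and it would force
    \<open>u = 0\<close>.\<close>
  moreover have "s \<noteq> 0"
  proof
    assume "s = 0"
    then have "u \<bullet> (x + u) \<le> u \<bullet> x"
      using le[of "x + u"] b by simp
    then have "u = 0"
      by (simp add: inner_add_right flip: power2_norm_eq_inner)
    with \<open>s = 0\<close> \<open>a \<noteq> 0\<close> show False
      by (simp add: a zero_prod_def)
  qed
  ultimately have "s < 0"
    by simp
  show ?thesis
  proof
    \<comment> \<open>Dividing by \<open>- s > 0\<close> rescales the normal so that its last
      component is -1; its first component is then the slope of an affine minorant touching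
      \<open>f\<close> at \<open>x\<close>.\<close>
    have "f x + (u /\<^sub>R (- s)) \<bullet> (y - x) \<le> f y" for y
      using le[of y] b \<open>s < 0\<close> by (simp add: inner_diff_right field_simps)
    then show "u /\<^sub>R (- s) \<in> subdifferential f x"
      by (simp add: subdifferential_def)
    \<comment> \<open>The functional is nonnegative at both \<open>k\<close> and \<open>- k\<close>,
      hence zero.\<close>
    show "(u /\<^sub>R (- s)) \<bullet> k = 0" if "k \<in> K" for k
      using D[OF that] D[of "- k"] that K b by (simp add: subspace_neg)
  qed
qed

text \<open>Split \<open>g\<close> into a part in the range of the transpose and a part
  \<open>w\<close> orthogonal to it. Such a \<open>w\<close> lies in the kernel of \<open>A\<close>,
  so \<open>g\<close> is orthogonal to \<open>w\<close>, which forces \<open>w = 0\<close>.\<close>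

lemma orthogonal_kernel_imp_range_transpose:
  fixes A :: "real^'n^'m"
  assumes orth: "\<And>k. A *v k = 0 \<Longrightarrow> g \<bullet> k = 0"
  obtains z where "g = transpose A *v z"
proof -
  let ?R = "range ((*v) (transpose A))"
  have span: "span ?R = ?R"
    unfolding span_eq_iff
    by (intro linear_subspace_image matrix_vector_mul_linear subspace_UNIV)
  obtain y w where y: "y \<in> ?R" and w: "\<And>r. r \<in> ?R \<Longrightarrow> orthogonal w r" and g: "g = y + w"
    using orthogonal_subspace_decomp_exists[of ?R g] unfolding span by metis
  obtain z where z: "y = transpose A *v z"
    using y by blast
  have "(A *v w) \<bullet> v = 0" for v
    using w[of "transpose A *v v"]
    by (simp add: orthogonal_def dot_lmul_matrix[symmetric] transpose_matrix_vector inner_commute)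
  then have "A *v w = 0"
    using inner_eq_zero_iff by blast
  then have "g \<bullet> w = 0"
    by (rule orth)
  moreover have "w \<bullet> y = 0"
    using w[OF y] by (simp add: orthogonal_def)
  ultimately have "w = 0"
    by (simp add: g inner_add_left inner_commute[of y])
  with g z that show ?thesis
    by simp
qed

lemma sigma_min_nonneg: "0 \<le> sigma_min M"
  unfolding sigma_min_def
proof (rule cINF_greatest)
  \<comment> \<open>A real infimum over the empty set would carry no information, so a unit vector
    is exhibited.\<close>
  show "{z :: real^'m. norm z = 1} \<noteq> {}"
    using norm_axis_1 by blast
qed simp

lemma sigma_min_mult_le: "sigma_min M * norm z \<le> norm (M *v z)"
proof (cases "z = 0")
  case False
  have "bdd_below ((\<lambda>z. norm (M *v z)) ` {z. norm z = 1})"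
    by (rule bdd_belowI[of _ 0]) auto
  then have "sigma_min M \<le> norm (M *v (z /\<^sub>R norm z))"
    unfolding sigma_min_def using False by (intro cINF_lower) auto
  also have "\<dots> = norm (M *v z) / norm z"
    by (simp add: matrix_vector_mult_scaleR divide_inverse mult.commute)
  finally show ?thesis
    using False by (simp add: field_simps)
qed simp

theorem theorem3p1:
  fixes x\<^sub>0 :: "real^'n"
    and N :: "'t::finite \<Rightarrow> real^'n \<Rightarrow> real"
    and h :: "real^'t \<Rightarrow> real"
    and f :: "real^'n \<Rightarrow> real"
    and A :: "real^'n^'m"
  assumes "x\<^sub>0 \<noteq> 0"
    and "\<And>i. is_norm (N i)"
    and "h \<in> nonneg_orthant \<rightarrow> {0..}"
    and "convex_on nonneg_orthant h"
    and "\<And>i. nondecreasing_in_coord h i"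
    and "\<exists>i. strictly_increasing_in_coord h i"
    and "\<And>x. f x = h (\<chi> i. N i x)"
    and "correlation x\<^sub>0 (subdifferential f x\<^sub>0)
           > ratio_or_infinity (norm (A *v (x\<^sub>0 /\<^sub>R norm x\<^sub>0))) (sigma_min (transpose A))"
  shows "\<not> is_arg_min f (\<lambda>x. A *v x = A *v x\<^sub>0) x\<^sub>0"
proof
  assume min: "is_arg_min f (\<lambda>x. A *v x = A *v x\<^sub>0) x\<^sub>0"
  define e where "e = x\<^sub>0 /\<^sub>R norm x\<^sub>0"
  define \<sigma> where "\<sigma> = sigma_min (transpose A)"
  have f: "f = (\<lambda>x. h (\<chi> i. N i x))"
    using assms(7) by blast
  have "convex_on UNIV f"
    unfolding f by (rule convex_on_compose_norms) (use assms in auto)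
  moreover have "subspace {k. A *v k = 0}"
    by (simp add: subspace_def matrix_vector_right_distrib matrix_vector_mult_scaleR)
  moreover have "f x\<^sub>0 \<le> f (x\<^sub>0 + k)" if "k \<in> {k. A *v k = 0}" for k
    using min that by (auto simp: is_arg_min_def matrix_vector_right_distrib not_less)
  ultimately obtain g where g: "g \<in> subdifferential f x\<^sub>0"
    and orth: "\<And>k. k \<in> {k. A *v k = 0} \<Longrightarrow> g \<bullet> k = 0"
    using subgradient_orthogonal_to_subspace by blast
  obtain z where z: "g = transpose A *v z"
    using orthogonal_kernel_imp_range_transpose[of A g] orth by blast
  \<comment> \<open>The origin may be infeasible, but the subgradient inequality holds at every
    point, so comparing with it is legitimate.\<close>
  have "f 0 < f x\<^sub>0"
    unfolding f using assms(1,2,5,6) compose_norms_zero_less by blast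
  moreover have "f x\<^sub>0 + g \<bullet> (0 - x\<^sub>0) \<le> f 0"
    using g unfolding subdifferential_def by blast
  ultimately have "g \<noteq> 0"
    by auto
  \<comment> \<open>For \<open>\<sigma> = 0\<close> the ratio is infinite, and no extended real
    exceeds it strictly.\<close>
  have "\<sigma> \<noteq> 0"
    using assms(8) by (auto simp: ratio_or_infinity_def \<sigma>_def)
  then have "0 < \<sigma>"
    using sigma_min_nonneg[of "transpose A"] by (simp add: \<sigma>_def)
  have "\<bar>g \<bullet> e\<bar> = \<bar>z \<bullet> (A *v e)\<bar>"
    by (simp add: z transpose_matrix_vector dot_lmul_matrix)
  also have "\<dots> \<le> norm z * norm (A *v e)"
    by (rule Cauchy_Schwarz_ineq2)
  \<comment> \<open>Since \<open>g\<close> is the image of \<open>z\<close> under the transpose,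
    \<open>\<sigma> * norm z \<le> norm g\<close>.\<close>
  also have "\<dots> \<le> (norm g / \<sigma>) * norm (A *v e)"
    using sigma_min_mult_le[of "transpose A" z] \<open>0 < \<sigma>\<close>
    by (intro mult_right_mono) (auto simp: \<sigma>_def z field_simps)
  finally have "\<bar>g \<bullet> e\<bar> / norm g \<le> norm (A *v e) / \<sigma>"
    using \<open>g \<noteq> 0\<close> \<open>0 < \<sigma>\<close> by (simp add: field_simps)
  moreover have "correlation x\<^sub>0 (subdifferential f x\<^sub>0) \<le> ereal (\<bar>g \<bullet> e\<bar> / norm g)"
    unfolding correlation_def e_def using g by (rule INF_lower)
  ultimately have "correlation x\<^sub>0 (subdifferential f x\<^sub>0) \<le> ereal (norm (A *v e) / \<sigma>)"
    by (meson ereal_less_eq(3) order_trans)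
  then show False
    using assms(8) \<open>\<sigma> \<noteq> 0\<close> by (simp add: ratio_or_infinity_def e_def \<sigma>_def)
qed

end
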